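(* Let $\mathscr{H}$ be a linearly ordered complete Heyting algebra, and let $\mathfrak{M}=(W,\{R_i\}_{i\in I},V)$ and $\mathfrak{M}'=(W',\{R_i'\}_{i\in I},V')$ be two domain-finite fuzzy Kripke models over $\mathscr{H}$. Let $\Phi^{-}$ be the set of minus-formulae. Then: (1) the greatest weak prebisimulation for the set $\Phi^{-}$ between $\mathfrak{M}$ and $\mathfrak{M}'$, if it exists, is the greatest backward prebisimulation between $\mathfrak{M}$ and $\mathfrak{M}'$; (2) the greatest weak bisimulation for the set $\Phi^{-}$ between $\mathfrak{M}$ and $\mathfrak{M}'$, if it exists, is the greatest backward bisimulation between $\mathfrak{M}$ and $\mathfrak{M}'$.
   Context: Let $\mathscr{H}=(H,\wedge,\vee,\rightarrow,0,1)$ be a complete Heyting algebra ($x\wedge y\leqslant z\Leftrightarrow x\leqslant y\rightarrow z$). Fuzzy sets and relations. A fuzzy subset of $A$ is a function $A\to H$; a fuzzy relation between $A$ and $B$ is a function $A\times B\to H$, and a fuzzy relation on $A$ is a function $A\times A\to H$. Order, joins and meets are pointwise; "greatest" refers to the pointwise order. A fuzzy relation is non-empty if it is not identically $0$. The inverse is $\varphi^{-1}(b,a)=\varphi(a,b)$. Compositions: $(\varphi\circ\psi)(a,c)=\bigvee_{b\in B}\varphi(a,b)\wedge\psi(b,c)$; for fuzzy subsets $f$ of $A$ and $g$ of $B$ and a fuzzy relation $\varphi$ between $A$ and $B$, $(f\circ\varphi)(b)=\bigvee_{a\in A}f(a)\wedge\varphi(a,b)$ and $(\varphi\circ g)(a)=\bigvee_{b\in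 B}\varphi(a,b)\wedge g(b)$. Language. Let $I$ be a finite index set and $PV$ a set of proposition letters. The set $\Phi$ of all modal formulae is given by the grammar $A::=\overline{t}\mid p\mid A\wedge A\mid A\rightarrow A\mid\square_iA\mid\lozenge_iA\mid\square_i^{-}A\mid\lozenge_i^{-}A$, where $i\in I$, $p\in PV$, and $\overline{t}$ is a truth constant, one for each $t\in H$. The set $\Phi^{-}$ of minus-formulae consists of the formulae in $\Phi$ containing none of the operators $\square_i,\lozenge_i$ ($i\in I$). Models. A fuzzy Kripke model over $\mathscr{H}$ is $\mathfrak{M}=(W,\{R_i\}_{i\in I},V)$ with $W$ a non-empty set, each $R_i$ a fuzzy relation on $W$, and $V$ assigning a value $V(w,p)\in H$ to each $w\in W$, $p\in PV$, with $V(w,\overline{t})=t$. $V$ is extended to all formulae by $V(w,A\wedge B)=V(w,A)\wedge V(w,B)$; $V(w,A\rightarrow B)=V(w,A)\rightarrow V(w,B)$; $V(w,\square_iA)=\bigwedge_{u\in W}(R_i(w,u)\rightarrow V(u,A))$; $V(w,\lozenge_iA)=\bigvee_{u\in W}(R_i(w,u)\wedge V(u,A))$; $V(w,\square_i^{-}A)=\bigwedge_{u\in W}(R_i(u,w)\rightarrow V(u,A))$; $V(w,\lozenge_i^{-}A)=\bigvee_{u\in W}(R_i(u,w)\wedge V(u,A))$. Write $V_A(w)=V(w,A)$, so $V_A$ is a fuzzy subset of $W$. The model is domain-finite if for all $i\in I$ and $u\in W$ the set $\{w\in W\mid R_i(w,u)>0\}$ is finite. Both models are over the same $\mathscr{H}$,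 $I$ and $PV$. Let $\varphi$ be a non-empty fuzzy relation between $W$ and $W'$. $\varphi$ is a backward bisimulation between $\mathfrak{M}$ and $\mathfrak{M}'$ if: (bb-1) $V_p\leqslant\varphi\circ V_p'$ and $V_p'\leqslant\varphi^{-1}\circ V_p$ for every $p\in PV$; (bb-2) $R_i\circ\varphi\leqslant\varphi\circ R_i'$ and $R_i'\circ\varphi^{-1}\leqslant\varphi^{-1}\circ R_i$ for every $i\in I$; (bb-3) $V_p\circ\varphi\leqslant V_p'$ and $V_p'\circ\varphi^{-1}\leqslant V_p$ for every $p\in PV$. It is a backward prebisimulation if it satisfies (bb-2) and (bb-3). For a non-empty set $\Psi$ of formulae, $\varphi$ is a weak bisimulation for $\Psi$ if: (wb-1) $V_p\leqslant V_p'\circ\varphi^{-1}$ and $V_p'\leqslant V_p\circ\varphi$ for every $p\in PV$; (wb-2) $\varphi^{-1}\circ V_A\leqslant V_A'$ and $\varphi\circ V_A'\leqslant V_A$ for every $A\in\Psi$. It is a weak prebisimulation for $\Psi$ if it satisfies (wb-2). *)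

theory Defs
  imports Main
begin

class complete_heyting_algebra = complete_lattice +
  fixes himp :: "'a \<Rightarrow> 'a \<Rightarrow> 'a"  (infixr \<open>\<rightarrow>\<^sub>H\<close> 60)
  assumes inf_le_iff_le_himp: "inf x y \<le> z \<longleftrightarrow> x \<le> y \<rightarrow>\<^sub>H z"

type_synonym ('a, 'h) fuzzy_set = "'a \<Rightarrow> 'h"
type_synonym ('a, 'b, 'h) fuzzy_rel = "'a \<Rightarrow> 'b \<Rightarrow> 'h"

definition nonempty_rel :: "('a, 'b, 'h::complete_heyting_algebra) fuzzy_rel \<Rightarrow> bool" where
  "nonempty_rel \<phi> \<longleftrightarrow> \<phi> \<noteq> (\<lambda>a b. bot)"

definition inv_rel :: "('a, 'b, 'h) fuzzy_rel \<Rightarrow> ('b, 'a, 'h) fuzzy_rel" where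
  "inv_rel \<phi> = (\<lambda>b a. \<phi> a b)"

definition rel_comp ::
  "('a, 'b, 'h::complete_heyting_algebra) fuzzy_rel \<Rightarrow> ('b, 'c, 'h) fuzzy_rel \<Rightarrow> ('a, 'c, 'h) fuzzy_rel"
  (infixl \<open>\<circ>\<^sub>r\<^sub>r\<close> 75) where
  "\<phi> \<circ>\<^sub>r\<^sub>r \<psi> = (\<lambda>a c. SUP b. inf (\<phi> a b) (\<psi> b c))"

definition set_rel_comp ::
  "('a, 'h::complete_heyting_algebra) fuzzy_set \<Rightarrow> ('a, 'b, 'h) fuzzy_rel \<Rightarrow> ('b, 'h) fuzzy_set"
  (infixl \<open>\<circ>\<^sub>s\<^sub>r\<close> 75) where
  "f \<circ>\<^sub>s\<^sub>r \<phi> = (\<lambda>b. SUP a. inf (f a) (\<phi> a b))"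

definition rel_set_comp ::
  "('a, 'b, 'h::complete_heyting_algebra) fuzzy_rel \<Rightarrow> ('b, 'h) fuzzy_set \<Rightarrow> ('a, 'h) fuzzy_set"
  (infixl \<open>\<circ>\<^sub>r\<^sub>s\<close> 75) where
  "\<phi> \<circ>\<^sub>r\<^sub>s g = (\<lambda>a. SUP b. inf (\<phi> a b) (g b))"

datatype (fm_indices: 'i, fm_letters: 'p, fm_consts: 'h) fm =
    Const 'h
  | Letter 'p
  | And "('i, 'p, 'h) fm" "('i, 'p, 'h) fm"
  | Imp "('i, 'p, 'h) fm" "('i, 'p, 'h) fm"
  | Box 'i "('i, 'p, 'h) fm"
  | Dia 'i "('i, 'p, 'h) fm"
  | BoxInv 'i "('i, 'p, 'h) fm"
  | DiaInv 'i "('i, 'p, 'h) fm"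

text \<open>
  The index set \<open>I\<close> and the set \<open>PV\<close> of proposition letters are explicit subsets of types, so that
  either of them may be empty. The universe of a model is a type, which is automatically non-empty.
  Components of a model at indices outside \<open>I\<close> or letters outside \<open>PV\<close> are never consulted.
\<close>

definition formulae :: "'i set \<Rightarrow> 'p set \<Rightarrow> ('i, 'p, 'h) fm set" where
  "formulae I PV = {A. fm_indices A \<subseteq> I \<and> fm_letters A \<subseteq> PV}"

primrec is_minus :: "('i, 'p, 'h) fm \<Rightarrow> bool" where
  "is_minus (Const t) \<longleftrightarrow> True"
| "is_minus (Letter p) \<longleftrightarrow> True"
| "is_minus (And A B) \<longleftrightarrow> is_minus A \<and> is_minus B"
| "is_minus (Imp A B) \<longleftrightarrow> is_minus A \<and> is_minus B"
| "is_minus (Box i A) \<longleftrightarrow> False"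
| "is_minus (Dia i A) \<longleftrightarrow> False"
| "is_minus (BoxInv i A) \<longleftrightarrow> is_minus A"
| "is_minus (DiaInv i A) \<longleftrightarrow> is_minus A"

definition minus_formulae :: "'i set \<Rightarrow> 'p set \<Rightarrow> ('i, 'p, 'h) fm set" where
  "minus_formulae I PV = {A \<in> formulae I PV. is_minus A}"

record ('w, 'i, 'p, 'h) fuzzy_kripke_model =
  rel :: "'i \<Rightarrow> ('w, 'w, 'h) fuzzy_rel"
  val :: "'w \<Rightarrow> 'p \<Rightarrow> 'h"

primrec eval_fm ::
  "('w, 'i, 'p, 'h::complete_heyting_algebra) fuzzy_kripke_model \<Rightarrow> ('i, 'p, 'h) fm \<Rightarrow> ('w, 'h) fuzzy_set"
where
  "eval_fm M (Const t) = (\<lambda>w. t)"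
| "eval_fm M (Letter p) = (\<lambda>w. val M w p)"
| "eval_fm M (And A B) = (\<lambda>w. inf (eval_fm M A w) (eval_fm M B w))"
| "eval_fm M (Imp A B) = (\<lambda>w. eval_fm M A w \<rightarrow>\<^sub>H eval_fm M B w)"
| "eval_fm M (Box i A) = (\<lambda>w. INF u. (rel M i w u \<rightarrow>\<^sub>H eval_fm M A u))"
| "eval_fm M (Dia i A) = (\<lambda>w. SUP u. inf (rel M i w u) (eval_fm M A u))"
| "eval_fm M (BoxInv i A) = (\<lambda>w. INF u. (rel M i u w \<rightarrow>\<^sub>H eval_fm M A u))"
| "eval_fm M (DiaInv i A) = (\<lambda>w. SUP u. inf (rel M i u w) (eval_fm M A u))"

definition domain_finite ::
  "'i set \<Rightarrow> ('w, 'i, 'p, 'h::complete_heyting_algebra) fuzzy_kripke_model \<Rightarrow> bool" where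
  "domain_finite I M \<longleftrightarrow> (\<forall>i\<in>I. \<forall>u. finite {w. rel M i w u > bot})"

definition backward_prebisimulation ::
  "'i set \<Rightarrow> 'p set \<Rightarrow> ('w, 'i, 'p, 'h::complete_heyting_algebra) fuzzy_kripke_model \<Rightarrow>
    ('v, 'i, 'p, 'h) fuzzy_kripke_model \<Rightarrow> ('w, 'v, 'h) fuzzy_rel \<Rightarrow> bool" where
  "backward_prebisimulation I PV M M' \<phi> \<longleftrightarrow>
     nonempty_rel \<phi> \<and>
     (\<forall>i\<in>I. rel M i \<circ>\<^sub>r\<^sub>r \<phi> \<le> \<phi> \<circ>\<^sub>r\<^sub>r rel M' i \<and>
            rel M' i \<circ>\<^sub>r\<^sub>r inv_rel \<phi> \<le> inv_rel \<phi> \<circ>\<^sub>r\<^sub>r rel M i) \<and>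
     (\<forall>p\<in>PV. eval_fm M (Letter p) \<circ>\<^sub>s\<^sub>r \<phi> \<le> eval_fm M' (Letter p) \<and>
             eval_fm M' (Letter p) \<circ>\<^sub>s\<^sub>r inv_rel \<phi> \<le> eval_fm M (Letter p))"

definition backward_bisimulation ::
  "'i set \<Rightarrow> 'p set \<Rightarrow> ('w, 'i, 'p, 'h::complete_heyting_algebra) fuzzy_kripke_model \<Rightarrow>
    ('v, 'i, 'p, 'h) fuzzy_kripke_model \<Rightarrow> ('w, 'v, 'h) fuzzy_rel \<Rightarrow> bool" where
  "backward_bisimulation I PV M M' \<phi> \<longleftrightarrow>
     backward_prebisimulation I PV M M' \<phi> \<and>
     (\<forall>p\<in>PV. eval_fm M (Letter p) \<le> \<phi> \<circ>\<^sub>r\<^sub>s eval_fm M' (Letter p) \<and>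
             eval_fm M' (Letter p) \<le> inv_rel \<phi> \<circ>\<^sub>r\<^sub>s eval_fm M (Letter p))"

definition weak_prebisimulation ::
  "('i, 'p, 'h) fm set \<Rightarrow> ('w, 'i, 'p, 'h::complete_heyting_algebra) fuzzy_kripke_model \<Rightarrow>
    ('v, 'i, 'p, 'h) fuzzy_kripke_model \<Rightarrow> ('w, 'v, 'h) fuzzy_rel \<Rightarrow> bool" where
  "weak_prebisimulation \<Psi> M M' \<phi> \<longleftrightarrow>
     nonempty_rel \<phi> \<and>
     (\<forall>A\<in>\<Psi>. inv_rel \<phi> \<circ>\<^sub>r\<^sub>s eval_fm M A \<le> eval_fm M' A \<and>
            \<phi> \<circ>\<^sub>r\<^sub>s eval_fm M' A \<le> eval_fm M A)"

definition weak_bisimulation ::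
  "'p set \<Rightarrow> ('i, 'p, 'h) fm set \<Rightarrow> ('w, 'i, 'p, 'h::complete_heyting_algebra) fuzzy_kripke_model \<Rightarrow>
    ('v, 'i, 'p, 'h) fuzzy_kripke_model \<Rightarrow> ('w, 'v, 'h) fuzzy_rel \<Rightarrow> bool" where
  "weak_bisimulation PV \<Psi> M M' \<phi> \<longleftrightarrow>
     weak_prebisimulation \<Psi> M M' \<phi> \<and>
     (\<forall>p\<in>PV. eval_fm M (Letter p) \<le> eval_fm M' (Letter p) \<circ>\<^sub>s\<^sub>r inv_rel \<phi> \<and>
             eval_fm M' (Letter p) \<le> eval_fm M (Letter p) \<circ>\<^sub>s\<^sub>r \<phi>)"

definition is_greatest :: "('a::order \<Rightarrow> bool) \<Rightarrow> 'a \<Rightarrow> bool" where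
  "is_greatest P x \<longleftrightarrow> P x \<and> (\<forall>y. P y \<longrightarrow> y \<le> x)"

end

theory Submission
  imports Defs
begin

text \<open>
  A fuzzy relation preserves the values of all formulae of a set \<open>\<Psi>\<close> in both directions iff it lies
  pointwise below the degree of agreement, which assigns to \<open>(w, w')\<close> the infimum over \<open>A \<in> \<Psi>\<close> of
  the biimplication between the values of \<open>A\<close> at \<open>w\<close> and at \<open>w'\<close>. The remaining conditions on weak
  (pre)bisimulations, being non-empty and covering the values of the letters, pass to larger
  relations. Hence a greatest weak (pre)bisimulation is necessarily equal to the degree of
  agreement, and the theorem rests on two facts about minus-formulae.

  Every backward prebisimulation is below the degree of agreement. This is invariance of
  minus-formulae, by induction on formulae (\<open>minus_formulae_invariant\<close>): the condition that edges can
  be pulled back along the relation is exactly what the inverse modalities need.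

  Conversely, edges can be pulled back along the degree of agreement. This is a Hennessy--Milner
  argument (\<open>agreement_simulates\<close>). Suppose that the edge from \<open>w\<close> to \<open>u\<close> and the agreement of \<open>u\<close>
  with \<open>u'\<close> meet in a value \<open>c\<close> that is not below the join, over all \<open>w'\<close>, of the agreement of \<open>w\<close>
  with \<open>w'\<close> met with the edge from \<open>w'\<close> to \<open>u'\<close>. By linearity, for every \<open>w'\<close> the edge to \<open>u'\<close> or the
  agreement with \<open>w\<close> is less than \<open>c\<close>. In the second case a single formula has value \<open>1\<close> at \<open>w\<close> and
  value less than \<open>c\<close> at \<open>w'\<close>; the truth constants make it possible to normalise in this way a formula
  on which \<open>w\<close> and \<open>w'\<close> disagree. As only finitely many \<open>w'\<close> matter, the conjunction \<open>B\<close> of these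
  formulae exists, and \<open>DiaInv i B\<close> has value at least \<open>c\<close> at \<open>u\<close> but less than \<open>c\<close> at \<open>u'\<close>. This
  contradicts the agreement of \<open>u\<close> and \<open>u'\<close> to degree at least \<open>c\<close>.
\<close>

section \<open>Complete Heyting algebras\<close>

lemma inf_himp_le: "inf x (x \<rightarrow>\<^sub>H y) \<le> (y::'h::complete_heyting_algebra)"
  by (metis inf.commute inf_le_iff_le_himp order_refl)

lemma himp_refl: "x \<rightarrow>\<^sub>H x = (top::'h::complete_heyting_algebra)"
  by (metis inf_le_iff_le_himp inf_le2 top.extremum_uniqueI)

lemma inf_SUP_le_iff:
  fixes a :: "'h::complete_heyting_algebra"
  shows "inf a (SUP x. f x) \<le> z \<longleftrightarrow> (\<forall>x. inf a (f x) \<le> z)"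
  by (metis (mono_tags, lifting) SUP_le_iff UNIV_I inf.commute inf_le_iff_le_himp)

section \<open>The degree of agreement\<close>

definition agreement ::
  "('i, 'p, 'h) fm set \<Rightarrow> ('w, 'i, 'p, 'h::complete_heyting_algebra) fuzzy_kripke_model \<Rightarrow>
    ('v, 'i, 'p, 'h) fuzzy_kripke_model \<Rightarrow> ('w, 'v, 'h) fuzzy_rel" where
  "agreement \<Psi> M M' = (\<lambda>w w'. INF A\<in>\<Psi>.
     inf (eval_fm M A w \<rightarrow>\<^sub>H eval_fm M' A w') (eval_fm M' A w' \<rightarrow>\<^sub>H eval_fm M A w))"

lemma agreement_inv: "agreement \<Psi> M' M = inv_rel (agreement \<Psi> M M')"
  by (simp add: agreement_def inv_rel_def inf.commute)

lemma le_agreement_iff: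
  "\<phi> \<le> agreement \<Psi> M M' \<longleftrightarrow>
     (\<forall>A\<in>\<Psi>. \<forall>w w'. inf (\<phi> w w') (eval_fm M A w) \<le> eval_fm M' A w' \<and>
                    inf (\<phi> w w') (eval_fm M' A w') \<le> eval_fm M A w)"
  by (auto simp: agreement_def le_fun_def le_INF_iff inf_le_iff_le_himp)

lemma inf_agreement_le:
  assumes "A \<in> \<Psi>"
  shows "inf (agreement \<Psi> M M' w w') (eval_fm M A w) \<le> eval_fm M' A w'"
  using assms le_agreement_iff[of "agreement \<Psi> M M'" \<Psi> M M'] by blast

lemma weak_prebisimulation_iff_le_agreement:
  "weak_prebisimulation \<Psi> M M' \<phi> \<longleftrightarrow> nonempty_rel \<phi> \<and> \<phi> \<le> agreement \<Psi> M M'"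
  unfolding le_agreement_iff
  by (auto simp: weak_prebisimulation_def rel_set_comp_def inv_rel_def le_fun_def SUP_le_iff)

lemma nonempty_rel_mono:
  assumes "nonempty_rel \<phi>" and "\<phi> \<le> \<psi>"
  shows "nonempty_rel \<psi>"
  using assms unfolding nonempty_rel_def le_fun_def fun_eq_iff
  by (metis bot.extremum_uniqueI)

lemma weak_bisimulation_mono:
  assumes "weak_bisimulation PV \<Psi> M M' \<phi>" and "\<phi> \<le> \<psi>" and "weak_prebisimulation \<Psi> M M' \<psi>"
  shows "weak_bisimulation PV \<Psi> M M' \<psi>"
proof -
  have "f \<circ>\<^sub>s\<^sub>r \<phi> \<le> f \<circ>\<^sub>s\<^sub>r \<psi>" for f
    using assms(2) by (auto simp: set_rel_comp_def le_fun_def intro!: SUP_mono' inf_mono)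
  moreover have "g \<circ>\<^sub>s\<^sub>r inv_rel \<phi> \<le> g \<circ>\<^sub>s\<^sub>r inv_rel \<psi>" for g
    using assms(2)
    by (auto simp: set_rel_comp_def inv_rel_def le_fun_def intro!: SUP_mono' inf_mono)
  ultimately show ?thesis
    using assms(1,3) unfolding weak_bisimulation_def by (meson order_trans)
qed

lemma greatest_weak_prebisimulation_eq_agreement:
  assumes "is_greatest (weak_prebisimulation \<Psi> M M') \<phi>"
  shows "\<phi> = agreement \<Psi> M M'"
  using assms
  by (metis antisym is_greatest_def nonempty_rel_mono order_refl
      weak_prebisimulation_iff_le_agreement)

lemma greatest_weak_bisimulation_eq_agreement:
  assumes "is_greatest (weak_bisimulation PV \<Psi> M M') \<phi>"
  shows "\<phi> = agreement \<Psi> M M'"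
proof (rule antisym)
  have weak: "weak_bisimulation PV \<Psi> M M' \<phi>"
    using assms by (simp add: is_greatest_def)
  then show le: "\<phi> \<le> agreement \<Psi> M M'"
    by (simp add: weak_bisimulation_def weak_prebisimulation_iff_le_agreement)
  then have "weak_prebisimulation \<Psi> M M' (agreement \<Psi> M M')"
    using weak nonempty_rel_mono
    by (auto simp: weak_bisimulation_def weak_prebisimulation_iff_le_agreement)
  then show "agreement \<Psi> M M' \<le> \<phi>"
    using assms weak_bisimulation_mono[OF weak le] by (simp add: is_greatest_def)
qed

section \<open>Invariance of minus-formulae under backward prebisimulations\<close>

text \<open>
  To bound \<open>f'\<close> at a predecessor \<open>u'\<close> of \<open>w'\<close>, the edge from \<open>u'\<close> is answered by edges into \<open>w\<close>;
  the box at \<open>w\<close> bounds \<open>f\<close> at their sources. This is why the box needs edges of the second model to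
  be pulled back, while the diamond needs this for edges of the first.
\<close>

lemma inverse_box_invariant:
  fixes \<phi> :: "('w, 'v, 'h::complete_heyting_algebra) fuzzy_rel"
  assumes bwd: "R' \<circ>\<^sub>r\<^sub>r inv_rel \<phi> \<le> inv_rel \<phi> \<circ>\<^sub>r\<^sub>r R"
    and inv: "\<And>u u'. inf (\<phi> u u') (f u) \<le> f' u'"
  shows "inf (\<phi> w w') (INF u. R u w \<rightarrow>\<^sub>H f u) \<le> (INF u'. R' u' w' \<rightarrow>\<^sub>H f' u')"
proof (rule INF_greatest)
  fix u'
  let ?box = "INF u. R u w \<rightarrow>\<^sub>H f u"
  have answer: "inf (R' u' w') (\<phi> w w') \<le> (SUP u. inf (\<phi> u u') (R u w))"
    using bwd by (auto simp: rel_comp_def inv_rel_def le_fun_def SUP_le_iff)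
  have "inf ?box (inf (\<phi> u u') (R u w)) \<le> f' u'" for u
  proof -
    have "?box \<le> R u w \<rightarrow>\<^sub>H f u"
      by (rule INF_lower) simp
    then have "inf ?box (R u w) \<le> f u"
      by (simp add: inf_le_iff_le_himp)
    then have "inf ?box (inf (\<phi> u u') (R u w)) \<le> inf (\<phi> u u') (f u)"
      by (metis inf.left_commute inf_mono order_refl)
    then show ?thesis
      using inv order_trans by blast
  qed
  then have "inf ?box (SUP u. inf (\<phi> u u') (R u w)) \<le> f' u'"
    by (simp add: inf_SUP_le_iff)
  then have "inf ?box (inf (R' u' w') (\<phi> w w')) \<le> f' u'"
    using answer by (meson inf_mono order_refl order_trans)
  then have "inf (inf (\<phi> w w') ?box) (R' u' w') \<le> f' u'"
    by (simp add: ac_simps)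
  then show "inf (\<phi> w w') ?box \<le> R' u' w' \<rightarrow>\<^sub>H f' u'"
    by (simp add: inf_le_iff_le_himp)
qed

lemma inverse_diamond_invariant:
  fixes \<phi> :: "('w, 'v, 'h::complete_heyting_algebra) fuzzy_rel"
  assumes fwd: "R \<circ>\<^sub>r\<^sub>r \<phi> \<le> \<phi> \<circ>\<^sub>r\<^sub>r R'"
    and inv: "\<And>u u'. inf (\<phi> u u') (f u) \<le> f' u'"
  shows "inf (\<phi> w w') (SUP u. inf (R u w) (f u)) \<le> (SUP u'. inf (R' u' w') (f' u'))"
  unfolding inf_SUP_le_iff
proof
  fix u
  let ?dia = "SUP u'. inf (R' u' w') (f' u')"
  have answer: "inf (R u w) (\<phi> w w') \<le> (SUP u'. inf (\<phi> u u') (R' u' w'))"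
    using fwd by (auto simp: rel_comp_def le_fun_def SUP_le_iff)
  have "inf (f u) (inf (\<phi> u u') (R' u' w')) \<le> ?dia" for u'
  proof -
    have "inf (f u) (inf (\<phi> u u') (R' u' w')) = inf (R' u' w') (inf (\<phi> u u') (f u))"
      by (simp add: inf.commute inf.left_commute)
    also have "\<dots> \<le> inf (R' u' w') (f' u')"
      using inv by (intro inf_mono) auto
    also have "\<dots> \<le> ?dia"
      by (rule SUP_upper) simp
    finally show ?thesis .
  qed
  then have "inf (f u) (SUP u'. inf (\<phi> u u') (R' u' w')) \<le> ?dia"
    by (simp add: inf_SUP_le_iff)
  then have "inf (f u) (inf (R u w) (\<phi> w w')) \<le> ?dia"
    using answer by (meson inf_mono order_refl order_trans)
  then show "inf (\<phi> w w') (inf (R u w) (f u)) \<le> ?dia"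
    by (simp add: ac_simps)
qed

lemma inf_invariant:
  fixes e :: "'h::complete_heyting_algebra"
  assumes "inf e a \<le> a'" and "inf e b \<le> b'"
  shows "inf e (inf a b) \<le> inf a' b'"
proof -
  have "inf e (inf a b) = inf (inf e a) (inf e b)"
    by (simp add: ac_simps)
  then show ?thesis
    using assms inf_mono by simp
qed

lemma himp_invariant:
  fixes e :: "'h::complete_heyting_algebra"
  assumes "inf e a' \<le> a" and "inf e b \<le> b'"
  shows "inf e (a \<rightarrow>\<^sub>H b) \<le> a' \<rightarrow>\<^sub>H b'"
proof -
  have "inf (inf e (a \<rightarrow>\<^sub>H b)) a' \<le> inf e (inf a (a \<rightarrow>\<^sub>H b))"
    using assms(1) by (meson inf_le1 inf_le2 inf_mono le_inf_iff order_refl order_trans)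
  also have "\<dots> \<le> inf e b"
    by (intro inf_mono inf_himp_le order_refl)
  also have "\<dots> \<le> b'"
    by (rule assms(2))
  finally show ?thesis
    by (simp add: inf_le_iff_le_himp)
qed

text \<open>
  The two inequalities must be proved together, because implication exchanges the two models.
\<close>

lemma minus_formulae_invariant:
  fixes \<phi> :: "('w, 'v, 'h::complete_heyting_algebra) fuzzy_rel"
  assumes bb: "backward_prebisimulation I PV M M' \<phi>"
    and "A \<in> minus_formulae I PV"
  shows "inf (\<phi> w w') (eval_fm M A w) \<le> eval_fm M' A w' \<and>
         inf (\<phi> w w') (eval_fm M' A w') \<le> eval_fm M A w"
  using assms(2)
proof (induction A arbitrary: w w')
  case (Letter p)
  then have "eval_fm M (Letter p) \<circ>\<^sub>s\<^sub>r \<phi> \<le> eval_fm M' (Letter p)"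
    and "eval_fm M' (Letter p) \<circ>\<^sub>s\<^sub>r inv_rel \<phi> \<le> eval_fm M (Letter p)"
    using bb by (auto simp: backward_prebisimulation_def minus_formulae_def formulae_def)
  then show ?case
    by (simp add: set_rel_comp_def inv_rel_def le_fun_def SUP_le_iff inf.commute)
next
  case (And A B)
  then have "inf (\<phi> w w') (eval_fm M A w) \<le> eval_fm M' A w'"
    "inf (\<phi> w w') (eval_fm M' A w') \<le> eval_fm M A w"
    "inf (\<phi> w w') (eval_fm M B w) \<le> eval_fm M' B w'"
    "inf (\<phi> w w') (eval_fm M' B w') \<le> eval_fm M B w"
    by (auto simp: minus_formulae_def formulae_def)
  then show ?case
    by (simp only: eval_fm.simps inf_invariant)
next
  case (Imp A B)
  then have "inf (\<phi> w w') (eval_fm M A w) \<le> eval_fm M' A w'"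
    "inf (\<phi> w w') (eval_fm M' A w') \<le> eval_fm M A w"
    "inf (\<phi> w w') (eval_fm M B w) \<le> eval_fm M' B w'"
    "inf (\<phi> w w') (eval_fm M' B w') \<le> eval_fm M B w"
    by (auto simp: minus_formulae_def formulae_def)
  then show ?case
    by (simp add: himp_invariant)
next
  case (BoxInv i A)
  then have "i \<in> I" and "A \<in> minus_formulae I PV"
    by (auto simp: minus_formulae_def formulae_def)
  then have bb2: "rel M i \<circ>\<^sub>r\<^sub>r \<phi> \<le> \<phi> \<circ>\<^sub>r\<^sub>r rel M' i"
      "rel M' i \<circ>\<^sub>r\<^sub>r inv_rel \<phi> \<le> inv_rel \<phi> \<circ>\<^sub>r\<^sub>r rel M i"
    and IH: "inf (\<phi> u u') (eval_fm M A u) \<le> eval_fm M' A u'"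
      "inf (inv_rel \<phi> u' u) (eval_fm M' A u') \<le> eval_fm M A u" for u u'
    using bb BoxInv.IH by (auto simp: backward_prebisimulation_def inv_rel_def)
  have "rel M i \<circ>\<^sub>r\<^sub>r inv_rel (inv_rel \<phi>) \<le> inv_rel (inv_rel \<phi>) \<circ>\<^sub>r\<^sub>r rel M' i"
    using bb2(1) by (simp add: inv_rel_def)
  from inverse_box_invariant[OF bb2(2) IH(1)] inverse_box_invariant[OF this IH(2)]
  show ?case
    by (simp add: inv_rel_def)
next
  case (DiaInv i A)
  then have "i \<in> I" and "A \<in> minus_formulae I PV"
    by (auto simp: minus_formulae_def formulae_def)
  then have bb2: "rel M i \<circ>\<^sub>r\<^sub>r \<phi> \<le> \<phi> \<circ>\<^sub>r\<^sub>r rel M' i"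
      "rel M' i \<circ>\<^sub>r\<^sub>r inv_rel \<phi> \<le> inv_rel \<phi> \<circ>\<^sub>r\<^sub>r rel M i"
    and IH: "inf (\<phi> u u') (eval_fm M A u) \<le> eval_fm M' A u'"
      "inf (inv_rel \<phi> u' u) (eval_fm M' A u') \<le> eval_fm M A u" for u u'
    using bb DiaInv.IH by (auto simp: backward_prebisimulation_def inv_rel_def)
  from inverse_diamond_invariant[OF bb2(1) IH(1)] inverse_diamond_invariant[OF bb2(2) IH(2)]
  show ?case
    by (simp add: inv_rel_def)
qed (simp_all add: minus_formulae_def)

lemma backward_prebisimulation_imp_weak:
  assumes "backward_prebisimulation I PV M M' \<phi>"
  shows "weak_prebisimulation (minus_formulae I PV) M M' \<phi>"
  using assms minus_formulae_invariant[OF assms]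
  by (simp add: weak_prebisimulation_iff_le_agreement le_agreement_iff
      backward_prebisimulation_def)

section \<open>The degree of agreement on minus-formulae is a backward prebisimulation\<close>

lemma minus_formulae_closed:
  "Const t \<in> minus_formulae I PV"
  "\<lbrakk>A \<in> minus_formulae I PV; B \<in> minus_formulae I PV\<rbrakk> \<Longrightarrow> And A B \<in> minus_formulae I PV"
  "\<lbrakk>A \<in> minus_formulae I PV; B \<in> minus_formulae I PV\<rbrakk> \<Longrightarrow> Imp A B \<in> minus_formulae I PV"
  "\<lbrakk>i \<in> I; A \<in> minus_formulae I PV\<rbrakk> \<Longrightarrow> DiaInv i A \<in> minus_formulae I PV"
  by (auto simp: minus_formulae_def formulae_def)

text \<open>
  Disagreement to degree less than \<open>c\<close> means that one of the two implications between the values of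
  some \<open>A\<close> is less than \<open>c\<close>. Replacing one side of that implication by the truth constant for the
  value of \<open>A\<close> at \<open>w\<close> gives a formula that is trivially true at \<open>w\<close> and has the value of the
  implication at \<open>w'\<close>.
\<close>

lemma separating_minus_formula:
  fixes M :: "('w, 'i, 'p, 'h::{complete_heyting_algebra, complete_linorder}) fuzzy_kripke_model"
  assumes "agreement (minus_formulae I PV) M M' w w' < c"
  obtains B where "B \<in> minus_formulae I PV" and "eval_fm M B w = top" and "eval_fm M' B w' < c"
proof -
  obtain A where A: "A \<in> minus_formulae I PV"
    and "inf (eval_fm M A w \<rightarrow>\<^sub>H eval_fm M' A w') (eval_fm M' A w' \<rightarrow>\<^sub>H eval_fm M A w) < c"
    using assms by (auto simp: agreement_def INF_less_iff)
  then consider "eval_fm M A w \<rightarrow>\<^sub>H eval_fm M' A w' < c" | "eval_fm M' A w' \<rightarrow>\<^sub>H eval_fm M A w < c"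
    by (metis le_inf_iff not_le)
  then show thesis
  proof cases
    case 1
    then show thesis
      using A that[of "Imp (Const (eval_fm M A w)) A"]
      by (simp add: minus_formulae_closed himp_refl)
  next
    case 2
    then show thesis
      using A that[of "Imp A (Const (eval_fm M A w))"]
      by (simp add: minus_formulae_closed himp_refl)
  qed
qed

lemma separating_minus_formula_finite:
  fixes M :: "('w, 'i, 'p, 'h::{complete_heyting_algebra, complete_linorder}) fuzzy_kripke_model"
  assumes "finite F" and "\<And>w'. w' \<in> F \<Longrightarrow> agreement (minus_formulae I PV) M M' w w' < c"
  shows "\<exists>B \<in> minus_formulae I PV. eval_fm M B w = top \<and> (\<forall>w'\<in>F. eval_fm M' B w' < c)"
  using assms
proof (induction F)
  case empty
  show ?case
    by (intro bexI[of _ "Const top"]) (simp_all add: minus_formulae_closed)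
next
  case (insert w' F)
  then obtain B where B: "B \<in> minus_formulae I PV" "eval_fm M B w = top"
    "\<forall>w'\<in>F. eval_fm M' B w' < c"
    by auto
  have "agreement (minus_formulae I PV) M M' w w' < c"
    using insert.prems by simp
  then obtain C where C: "C \<in> minus_formulae I PV" "eval_fm M C w = top" "eval_fm M' C w' < c"
    by (rule separating_minus_formula)
  have "eval_fm M (And B C) w = top"
    using B C by simp
  moreover have "\<forall>w'\<in>insert w' F. eval_fm M' (And B C) w' < c"
    using B(3) C(3) by (auto intro: le_less_trans[OF inf_le1] le_less_trans[OF inf_le2])
  ultimately show ?case
    using minus_formulae_closed(2)[OF B(1) C(1)] by blast
qed

lemma SUP_less_of_finite_support:
  fixes f :: "'a \<Rightarrow> 'h::complete_linorder"
  assumes "finite {x. f x > bot}" and "\<And>x. f x < c"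
  shows "(SUP x. f x) < c"
proof -
  have "range f \<subseteq> insert bot (f ` {x. f x > bot})"
    using bot.not_eq_extremum by auto
  then have "finite (range f)"
    using assms(1) finite_subset by blast
  then show ?thesis
    using assms(2) by (subst finite_Sup_less_iff) auto
qed

text \<open>
  The Hennessy--Milner step. Finiteness of the set of predecessors of \<open>u'\<close> is used twice: for the
  separating conjunction to be a formula, and for a join of values less than \<open>c\<close> to stay less
  than \<open>c\<close>.
\<close>

lemma agreement_simulates:
  fixes I :: "'i set" and PV :: "'p set"
    and M :: "('w, 'i, 'p, 'h::{complete_heyting_algebra, complete_linorder}) fuzzy_kripke_model"
    and M' :: "('v, 'i, 'p, 'h) fuzzy_kripke_model"
  assumes "domain_finite I M'" and "i \<in> I"
  defines "\<phi> \<equiv> agreement (minus_formulae I PV) M M'"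
  shows "rel M i \<circ>\<^sub>r\<^sub>r \<phi> \<le> \<phi> \<circ>\<^sub>r\<^sub>r rel M' i"
proof -
  have "inf (rel M i w u) (\<phi> u u') \<le> (SUP w'. inf (\<phi> w w') (rel M' i w' u'))" for w u u'
  proof (rule ccontr)
    define c where "c = inf (rel M i w u) (\<phi> u u')"
    assume "\<not> inf (rel M i w u) (\<phi> u u') \<le> (SUP w'. inf (\<phi> w w') (rel M' i w' u'))"
    then have "(SUP w'. inf (\<phi> w w') (rel M' i w' u')) < c"
      by (simp add: c_def not_le)
    then have less: "inf (\<phi> w w') (rel M' i w' u') < c" for w'
      by (meson SUP_upper UNIV_I le_less_trans)
    then have "bot < c"
      using bot.extremum le_less_trans by blast
    \<comment> \<open>Predecessors whose edge has degree less than \<open>c\<close> need no separating formula.\<close>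
    define F where "F = {w'. c \<le> rel M' i w' u'}"
    have pred_fin: "finite {w'. bot < rel M' i w' u'}"
      using assms(1,2) by (simp add: domain_finite_def)
    have "finite F"
      using \<open>bot < c\<close> by (intro finite_subset[OF _ pred_fin]) (auto simp: F_def)
    moreover have "agreement (minus_formulae I PV) M M' w w' < c" if "w' \<in> F" for w'
      using less[of w'] that by (metis F_def \<phi>_def le_inf_iff mem_Collect_eq not_le)
    ultimately obtain B where B: "B \<in> minus_formulae I PV" "eval_fm M B w = top"
      "\<forall>w'\<in>F. eval_fm M' B w' < c"
      using separating_minus_formula_finite[where F = F and M = M and M' = M' and w = w] by blast
    have "inf (rel M i w u) (eval_fm M B w) \<le> eval_fm M (DiaInv i B) u"
      unfolding eval_fm.simps by (rule SUP_upper) simp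
    then have "c \<le> eval_fm M (DiaInv i B) u"
      using B(2) by (simp add: c_def le_infI1)
    then have "c \<le> inf (\<phi> u u') (eval_fm M (DiaInv i B) u)"
      by (simp add: c_def)
    also have "\<dots> \<le> eval_fm M' (DiaInv i B) u'"
      unfolding \<phi>_def by (rule inf_agreement_le) (simp add: minus_formulae_closed assms(2) B(1))
    finally have "c \<le> eval_fm M' (DiaInv i B) u'" .
    moreover have "eval_fm M' (DiaInv i B) u' < c"
      unfolding eval_fm.simps
    proof (rule SUP_less_of_finite_support)
      show "finite {w'. bot < inf (rel M' i w' u') (eval_fm M' B w')}"
        by (rule finite_subset[OF _ pred_fin]) (auto intro: less_le_trans)
      show "inf (rel M' i w' u') (eval_fm M' B w') < c" for w'
        using B(3) by (metis F_def le_inf_iff mem_Collect_eq not_le)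
    qed
    ultimately show False
      by simp
  qed
  then show ?thesis
    by (auto simp: rel_comp_def le_fun_def SUP_le_iff)
qed

lemma agreement_letter:
  assumes "p \<in> PV"
  shows "eval_fm M (Letter p) \<circ>\<^sub>s\<^sub>r agreement (minus_formulae I PV) M M' \<le> eval_fm M' (Letter p)"
proof -
  have "Letter p \<in> minus_formulae I PV"
    using assms by (simp add: minus_formulae_def formulae_def)
  from inf_agreement_le[OF this, of M M'] show ?thesis
    by (simp add: set_rel_comp_def le_fun_def SUP_le_iff inf.commute)
qed

lemma agreement_backward_prebisimulation:
  fixes M :: "('w, 'i, 'p, 'h::{complete_heyting_algebra, complete_linorder}) fuzzy_kripke_model"
    and M' :: "('v, 'i, 'p, 'h) fuzzy_kripke_model"
  assumes "domain_finite I M" and "domain_finite I M'"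
    and "nonempty_rel (agreement (minus_formulae I PV) M M')"
  shows "backward_prebisimulation I PV M M' (agreement (minus_formulae I PV) M M')"
  using assms(3) agreement_letter[where M = M and M' = M'] agreement_letter[where M = M' and M' = M]
    agreement_simulates[OF assms(2), where M = M and PV = PV]
    agreement_simulates[OF assms(1), where M = M' and PV = PV]
  by (simp add: backward_prebisimulation_def agreement_inv[of _ M' M])

section \<open>Greatest weak and backward (pre)bisimulations\<close>

text \<open>
  The covering conditions on the letters are the same for both notions, since the meet inside the
  compositions is commutative.
\<close>

lemma weak_bisimulation_iff_backward_bisimulation:
  assumes "weak_prebisimulation \<Psi> M M' \<phi>" and "backward_prebisimulation I PV M M' \<phi>"
  shows "weak_bisimulation PV \<Psi> M M' \<phi> \<longleftrightarrow> backward_bisimulation I PV M M' \<phi>"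
  using assms
  by (simp add: weak_bisimulation_def backward_bisimulation_def set_rel_comp_def rel_set_comp_def
      inv_rel_def inf.commute)

theorem theorem3:
  fixes I :: "'i set" and PV :: "'p set"
    and M :: "('w, 'i, 'p, 'h::{complete_heyting_algebra, complete_linorder}) fuzzy_kripke_model"
    and M' :: "('v, 'i, 'p, 'h) fuzzy_kripke_model"
  assumes "finite I"
    and "domain_finite I M" and "domain_finite I M'"
  shows "(\<forall>\<phi>. is_greatest (weak_prebisimulation (minus_formulae I PV) M M') \<phi> \<longrightarrow>
              is_greatest (backward_prebisimulation I PV M M') \<phi>) \<and>
         (\<forall>\<phi>. is_greatest (weak_bisimulation PV (minus_formulae I PV) M M') \<phi> \<longrightarrow>
              is_greatest (backward_bisimulation I PV M M') \<phi>)"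
proof (intro conjI allI impI)
  fix \<phi>
  assume greatest: "is_greatest (weak_prebisimulation (minus_formulae I PV) M M') \<phi>"
  then have "nonempty_rel \<phi>"
    by (simp add: is_greatest_def weak_prebisimulation_def)
  then have "backward_prebisimulation I PV M M' \<phi>"
    using agreement_backward_prebisimulation[OF assms(2,3)]
      greatest_weak_prebisimulation_eq_agreement[OF greatest] by simp
  then show "is_greatest (backward_prebisimulation I PV M M') \<phi>"
    using greatest backward_prebisimulation_imp_weak unfolding is_greatest_def by blast
next
  fix \<phi>
  assume greatest: "is_greatest (weak_bisimulation PV (minus_formulae I PV) M M') \<phi>"
  then have weak: "weak_bisimulation PV (minus_formulae I PV) M M' \<phi>"
    by (simp add: is_greatest_def)
  then have weak_pre: "weak_prebisimulation (minus_formulae I PV) M M' \<phi>"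
    by (simp add: weak_bisimulation_def)
  then have "backward_prebisimulation I PV M M' \<phi>"
    using agreement_backward_prebisimulation[OF assms(2,3)]
      greatest_weak_bisimulation_eq_agreement[OF greatest]
    by (simp add: weak_prebisimulation_def)
  then have "backward_bisimulation I PV M M' \<phi>"
    using weak weak_pre weak_bisimulation_iff_backward_bisimulation by blast
  moreover have "\<psi> \<le> \<phi>" if "backward_bisimulation I PV M M' \<psi>" for \<psi>
  proof -
    have pre: "backward_prebisimulation I PV M M' \<psi>"
      using that by (simp add: backward_bisimulation_def)
    have "weak_bisimulation PV (minus_formulae I PV) M M' \<psi>"
      using that weak_bisimulation_iff_backward_bisimulation
        backward_prebisimulation_imp_weak[OF pre] pre by blast
    then show ?thesis
      using greatest by (simp add: is_greatest_def)
  qed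
  ultimately show "is_greatest (backward_bisimulation I PV M M') \<phi>"
    by (simp add: is_greatest_def)
qed

end
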